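(* Let $R$ and $Q$ be two probability measures on $C[0,\infty)$ such that the coordinate process $X$ is a positive strict local martingale under $R$, is a nonnegative martingale under $Q$, and such that the probability measure $P$ defined by $P(A)=E^Q(X_t1_A)$ for all $A\in\mathcal F_t$, $t\ge0$, is the law of the process $\{1/X_t,\ t\ge0\}$ under $R$. Let $\tau_0$ denote the hitting time of zero of the coordinate process $X$. Consider any nonnegative function $h:(0,\infty)\to\mathbb R^+$. For any bounded stopping time $\tau$, one has $$E^R\left(h(X_{\tau})\right)=E^Q\left(g(X_\tau)1_{\{\tau_0>\tau\}}\right),$$ where $g$ is the function $g(x)=x\,h(1/x)$ for all $x>0$. Now suppose that $\lim_{x\to0}g(x)=\eta<\infty$. Define $\bar g:[0,\infty)\to\mathbb R$ by extending $g$ continuously, i.e. $\bar g(x)=g(x)$ for $x>0$ and $\bar g(0)=\eta$. Then $$E^R\left(h(X_{\tau})\right)=E^Q\left(\bar g(X_\tau)\right)-\eta\,Q(\tau_0\le\tau).$$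
   Context: A strict local martingale is a local martingale which is not a martingale. $C[0,\infty)$ is the canonical space of continuous paths, $X_t(\omega)=\omega(t)$ is the coordinate process, and $\{\mathcal F_t\}$ is the filtration generated by $X$; stopping times are with respect to this filtration. $E^R$ and $E^Q$ denote expectation under $R$ and $Q$. $\mathbb R^+$ denotes the nonnegative reals.
   Formalization: Under R the stopping time is evaluated on the reciprocal path, i.e. X is taken at time τ(1/X), while under Q it is τ(X); with the same functional τ on both sides the formula is false (e.g. τ the first time X reaches 2, capped at T, h(x)=x). h is assumed Borel measurable. *)

theory Defs
  imports "HOL-Probability.Probability"
begin

section \<open>The canonical path space\<close>

text \<open>
  A path is a real function that is continuous on the half line; requiring it to be
  extensional fixes its (irrelevant) values at negative times, so that a path is determined
  by its values on \<open>{0..}\<close>.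
\<close>

definition paths :: "(real \<Rightarrow> real) set" where
  "paths = {\<omega> \<in> extensional {0..}. continuous_on {0..} \<omega>}"

definition coord :: "real \<Rightarrow> (real \<Rightarrow> real) \<Rightarrow> real" where
  "coord t \<omega> = \<omega> t"

text \<open>
  The raw filtration: no completion and no right-continuous modification. Times are reals,
  and for negative \<open>t\<close> the sigma-algebra is trivial.
\<close>

definition path_filtration :: "real \<Rightarrow> (real \<Rightarrow> real) measure" where
  "path_filtration t =
     sigma paths {{\<omega> \<in> paths. coord s \<omega> \<in> B} | s B. 0 \<le> s \<and> s \<le> t \<and> B \<in> sets borel}"

definition path_space :: "(real \<Rightarrow> real) measure" where
  "path_space = sigma paths {{\<omega> \<in> paths. coord s \<omega> \<in> B} | s B. 0 \<le> s \<and> B \<in> sets borel}"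

text \<open>First hitting time of zero; it is \<open>\<infinity>\<close> (the infimum of the empty set) if zero is never hit.\<close>

definition hit_zero :: "(real \<Rightarrow> real) \<Rightarrow> ereal" where
  "hit_zero \<omega> = Inf {ereal t | t. 0 \<le> t \<and> coord t \<omega> = 0}"

text \<open>
  The path of the reciprocal process. It is only meaningful for strictly positive paths; other
  paths are left unchanged, to have a total map of the path space into itself.
\<close>

definition recip_path :: "(real \<Rightarrow> real) \<Rightarrow> (real \<Rightarrow> real)" where
  "recip_path \<omega> = (if \<forall>t\<ge>0. 0 < coord t \<omega> then (\<lambda>t\<in>{0..}. 1 / coord t \<omega>) else \<omega>)"

section \<open>Martingales and local martingales in continuous time\<close>

definition martingale ::
    "'a measure \<Rightarrow> (real \<Rightarrow> 'a measure) \<Rightarrow> (real \<Rightarrow> 'a \<Rightarrow> real) \<Rightarrow> bool" where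
  "martingale M F X \<longleftrightarrow>
     (\<forall>t\<ge>0. X t \<in> borel_measurable (F t) \<and> integrable M (X t)) \<and>
     (\<forall>s t. 0 \<le> s \<and> s \<le> t \<longrightarrow> (AE \<omega> in M. real_cond_exp M (F s) (X t) \<omega> = X s \<omega>))"

text \<open>
  Real-valued localizing times are no restriction: extended-valued times \<open>T n\<close> can be replaced
  by the minimum of \<open>T n\<close> and \<open>n\<close>.
\<close>

definition local_martingale ::
    "'a measure \<Rightarrow> (real \<Rightarrow> 'a measure) \<Rightarrow> (real \<Rightarrow> 'a \<Rightarrow> real) \<Rightarrow> bool" where
  "local_martingale M F X \<longleftrightarrow>
     (\<forall>t\<ge>0. X t \<in> borel_measurable (F t)) \<and>
     (\<exists>T :: nat \<Rightarrow> 'a \<Rightarrow> real.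
        (\<forall>n. stopping_time F (T n) \<and> (\<forall>\<omega>\<in>space M. 0 \<le> T n \<omega>)) \<and>
        (AE \<omega> in M. incseq (\<lambda>n. T n \<omega>) \<and> filterlim (\<lambda>n. T n \<omega>) at_top sequentially) \<and>
        (\<forall>n. martingale M F (\<lambda>t \<omega>. X (min t (T n \<omega>)) \<omega>)))"

definition strict_local_martingale ::
    "'a measure \<Rightarrow> (real \<Rightarrow> 'a measure) \<Rightarrow> (real \<Rightarrow> 'a \<Rightarrow> real) \<Rightarrow> bool" where
  "strict_local_martingale M F X \<longleftrightarrow> local_martingale M F X \<and> \<not> martingale M F X"

section \<open>Bounded stopping times on the path space\<close>

definition bounded_stopping_time :: "((real \<Rightarrow> real) \<Rightarrow> real) \<Rightarrow> bool" where
  "bounded_stopping_time \<tau> \<longleftrightarrow>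
     stopping_time path_filtration \<tau> \<and> (\<exists>K. \<forall>\<omega>\<in>paths. 0 \<le> \<tau> \<omega> \<and> \<tau> \<omega> \<le> K)"

text \<open>
  A stopping time \<open>\<tau>\<close> is a functional of the path. The measure \<open>P\<close> relates \<open>Q\<close> to the law of the
  reciprocal of the coordinate process under \<open>R\<close>, so one and the same random time is \<open>\<tau>\<close> as a
  functional of the path under \<open>Q\<close> (and \<open>P\<close>), and \<open>\<tau>\<close> as a functional of the reciprocal path under
  \<open>R\<close>. The two functionals coincide when \<open>\<tau>\<close> is deterministic, but not in general: the first time
  the coordinate process reaches 2 becomes the first time it reaches 1/2.
\<close>

definition recip_time :: "((real \<Rightarrow> real) \<Rightarrow> real) \<Rightarrow> (real \<Rightarrow> real) \<Rightarrow> real" where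
  "recip_time \<tau> \<omega> = \<tau> (recip_path \<omega>)"

end

theory Submission
  imports Defs
begin

text \<open>
  Write \<open>\<tau>\<^sub>n\<close> for \<open>\<tau>\<close> rounded up to the grid of mesh \<open>1/(n+1)\<close>. On \<open>{\<tau>\<^sub>n = t}\<close> the density of \<open>P\<close>
  with respect to \<open>Q\<close> is \<open>X\<^sub>t\<close>, so \<open>E\<^sup>P \<phi>(X(\<tau>\<^sub>n)) = E\<^sup>Q X(\<tau>\<^sub>n) \<phi>(X(\<tau>\<^sub>n))\<close> for every \<open>\<phi>\<close>. For continuous
  \<open>\<phi>\<close> vanishing for large arguments both sides converge, and hence the law of \<open>X\<^sub>\<tau>\<close> under \<open>P\<close> has
  density \<open>x\<close> with respect to its law under \<open>Q\<close>. As \<open>P\<close> is the law of the reciprocal process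
  under \<open>R\<close>, this turns \<open>h(X\<^sub>\<tau>)\<close> under \<open>R\<close> into \<open>X\<^sub>\<tau> h(1/X\<^sub>\<tau>)\<close> under \<open>Q\<close>. Finally, \<open>P\<close> lives on
  positive paths, which forces \<open>X\<close> to stay at zero \<open>Q\<close>-almost surely once it has hit zero.
\<close>

section \<open>Zeros and reciprocals of continuous paths\<close>


lemma space_path_space [simp]: "space path_space = paths"
  and space_path_filtration [simp]: "space (path_filtration t) = paths"
  unfolding path_space_def path_filtration_def by (auto intro!: space_measure_of)

lemma measurable_coord_filtration:
  assumes "0 \<le> s" "s \<le> t"
  shows "coord s \<in> borel_measurable (path_filtration t)"
proof (rule measurableI)
  fix B :: "real set" assume "B \<in> sets borel"
  moreover have "coord s -` B \<inter> paths = {\<omega> \<in> paths. coord s \<omega> \<in> B}"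
    by auto
  ultimately show "coord s -` B \<inter> space (path_filtration t) \<in> sets (path_filtration t)"
    using assms unfolding space_path_filtration unfolding path_filtration_def
    by (intro in_measure_of) auto
qed simp

lemma measurable_coord: "0 \<le> s \<Longrightarrow> coord s \<in> borel_measurable path_space"
proof (rule measurableI)
  fix B :: "real set" assume "0 \<le> s" "B \<in> sets borel"
  moreover have "coord s -` B \<inter> paths = {\<omega> \<in> paths. coord s \<omega> \<in> B}"
    by auto
  ultimately show "coord s -` B \<inter> space path_space \<in> sets path_space"
    unfolding space_path_space unfolding path_space_def by (intro in_measure_of) auto
qed simp

lemma subalgebra_path_filtration_mono: "s \<le> t \<Longrightarrow> subalgebra (path_filtration t) (path_filtration s)"
  unfolding subalgebra_def space_path_filtration
  unfolding path_filtration_def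
  by (subst (1 2) sets_measure_of) (auto intro!: sigma_sets_mono' intro: order_trans)

lemma subalgebra_path_filtration: "subalgebra path_space (path_filtration t)"
  unfolding subalgebra_def space_path_filtration space_path_space
  unfolding path_space_def path_filtration_def
  by (subst (1 2) sets_measure_of) (auto intro!: sigma_sets_mono')

text \<open>Cylinder sets generate \<open>path_space\<close>, so only the coordinates of a
  path-valued map have to be checked.\<close>

lemma measurable_into_path_space:
  assumes "\<And>x. x \<in> space M \<Longrightarrow> f x \<in> paths"
    and "\<And>s. 0 \<le> s \<Longrightarrow> (\<lambda>x. coord s (f x)) \<in> borel_measurable M"
  shows "f \<in> measurable M path_space"
  unfolding path_space_def
proof (rule measurable_measure_of)
  fix A assume "A \<in> {{\<omega> \<in> paths. coord s \<omega> \<in> B} |s B. 0 \<le> s \<and> B \<in> sets borel}"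
  then obtain s B where *: "A = {\<omega> \<in> paths. coord s \<omega> \<in> B}" "0 \<le> s" "B \<in> sets borel"
    by auto
  then have "f -` A \<inter> space M = (\<lambda>x. coord s (f x)) -` B \<inter> space M"
    using assms(1) by auto
  with * show "f -` A \<inter> space M \<in> sets M"
    using assms(2) by (simp add: measurable_sets)
qed (use assms(1) in auto)

section \<open>Path continuity and the hitting time of zero\<close>

lemma tendsto_of_le_add_inverse:
  fixes u :: "nat \<Rightarrow> real"
  assumes "\<And>n. t \<le> u n" "\<And>n. u n \<le> t + 1 / Suc n"
  shows "u \<longlonglongrightarrow> t"
proof (rule tendsto_sandwich[where f = "\<lambda>_. t" and h = "\<lambda>n. t + 1 / Suc n"])
  show "(\<lambda>n. t + 1 / Suc n) \<longlonglongrightarrow> t"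
    using tendsto_add[OF tendsto_const LIMSEQ_inverse_real_of_nat, of t] by (simp add: inverse_eq_divide)
qed (intro always_eventually allI assms tendsto_const)+

lemma continuous_on_coord: "\<omega> \<in> paths \<Longrightarrow> continuous_on {0..} (\<lambda>t. coord t \<omega>)"
  by (simp add: paths_def coord_def)

lemma tendsto_coord:
  assumes "\<omega> \<in> paths" "\<And>n. 0 \<le> u n" "0 \<le> t" "u \<longlonglongrightarrow> t"
  shows "(\<lambda>n. coord (u n) \<omega>) \<longlonglongrightarrow> coord t \<omega>"
  using assms continuous_on_tendsto_compose[OF continuous_on_coord, of \<omega> u t sequentially] by simp

text \<open>The zeros of a continuous path form a closed set, so the infimum is attained.
  Concretely, if \<open>[0,T]\<close> contains no zero, continuity at \<open>T\<close> extends the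
  zero-free interval to some \<open>d > T\<close>, which is then a lower bound of all zeros.\<close>

lemma hit_zero_le_iff:
  assumes \<omega>: "\<omega> \<in> paths" and T: "0 \<le> T"
  shows "hit_zero \<omega> \<le> ereal T \<longleftrightarrow> (\<exists>s\<in>{0..T}. coord s \<omega> = 0)"
proof
  assume le: "hit_zero \<omega> \<le> ereal T"
  show "\<exists>s\<in>{0..T}. coord s \<omega> = 0"
  proof (rule ccontr)
    assume no: "\<not> ?thesis"
    obtain d where d: "T < d" "\<forall>s\<in>{0..d}. coord s \<omega> \<noteq> 0"
    proof -
      \<comment> \<open>The \<open>max 0\<close> extends the path continuously to the whole line, so
        that two-sided continuity makes sense even at \<open>T = 0\<close>.\<close>
      have "isCont (\<lambda>s. coord (max 0 s) \<omega>) T"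
        by (rule continuous_on_interior[of UNIV])
          (auto intro!: continuous_intros continuous_on_compose2[OF continuous_on_coord[OF \<omega>]])
      moreover have "coord (max 0 T) \<omega> \<noteq> 0"
        using no T by auto
      ultimately have "eventually (\<lambda>s. coord (max 0 s) \<omega> \<noteq> 0) (at T)"
        unfolding isCont_def by (rule tendsto_imp_eventually_ne)
      then obtain e where "e > 0" and e: "\<And>s. s \<noteq> T \<Longrightarrow> dist s T < e \<Longrightarrow> coord (max 0 s) \<omega> \<noteq> 0"
        unfolding eventually_at by auto
      show ?thesis
      proof (rule that[of "T + e/2"])
        show "\<forall>s\<in>{0..T + e/2}. coord s \<omega> \<noteq> 0"
        proof
          fix s assume s: "s \<in> {0..T + e/2}"
          show "coord s \<omega> \<noteq> 0"
          proof (cases "s \<le> T")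
            case True with s no show ?thesis by auto
          next
            case False with s e[of s] \<open>e > 0\<close> T show ?thesis by (auto simp: dist_real_def)
          qed
        qed
      qed (use \<open>e > 0\<close> in simp)
    qed
    have "ereal d \<le> hit_zero \<omega>"
      unfolding hit_zero_def using d by (intro Inf_greatest) (auto simp: not_le[symmetric])
    with le d(1) show False
      by (meson ereal_less_eq(3) leD order_trans)
  qed
next
  assume "\<exists>s\<in>{0..T}. coord s \<omega> = 0"
  then obtain s where "0 \<le> s" "s \<le> T" "coord s \<omega> = 0" by auto
  then have "hit_zero \<omega> \<le> ereal s"
    unfolding hit_zero_def by (auto intro!: Inf_lower)
  with \<open>s \<le> T\<close> show "hit_zero \<omega> \<le> ereal T"
    by (meson ereal_less_eq(3) order_trans)
qed

text \<open>This countable form is what makes the event measurable. Clamping sends every rational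
  into \<open>[0,T]\<close>, so an irrational \<open>T\<close> or the one-point interval
  \<open>T = 0\<close> needs no separate treatment. Conversely, \<bar>\<open>coord\<close>\<bar>
  attains its minimum on the compact interval, and a minimum below every \<open>1 / Suc n\<close> is
  zero.\<close>

lemma hit_zero_le_iff_rat:
  assumes \<omega>: "\<omega> \<in> paths" and T: "0 \<le> T"
  shows "hit_zero \<omega> \<le> ereal T \<longleftrightarrow>
    (\<forall>n::nat. \<exists>q::rat. \<bar>coord (min (max 0 (of_rat q)) T) \<omega>\<bar> < 1 / Suc n)"
  unfolding hit_zero_le_iff[OF assms]
proof
  assume "\<exists>s\<in>{0..T}. coord s \<omega> = 0"
  then obtain s where s: "0 \<le> s" "s \<le> T" "coord s \<omega> = 0" by auto
  show "\<forall>n::nat. \<exists>q::rat. \<bar>coord (min (max 0 (of_rat q)) T) \<omega>\<bar> < 1 / Suc n"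
  proof
    fix n :: nat
    have cont: "continuous_on UNIV (\<lambda>s. \<bar>coord (min (max 0 s) T) \<omega>\<bar>)"
      using T by (intro continuous_intros continuous_on_compose2[OF continuous_on_coord[OF \<omega>]]) auto
    have "open {s. \<bar>coord (min (max 0 s) T) \<omega>\<bar> < 1 / Suc n}"
      by (intro open_Collect_less cont continuous_intros)
    moreover have "s \<in> {s. \<bar>coord (min (max 0 s) T) \<omega>\<bar> < 1 / Suc n}"
      using s by (simp add: min_absorb1)
    ultimately obtain e where e: "e > 0" "\<And>y. \<bar>y - s\<bar> < e \<Longrightarrow> \<bar>coord (min (max 0 y) T) \<omega>\<bar> < 1 / Suc n"
      unfolding open_dist dist_real_def by blast
    obtain q :: rat where "s < of_rat q" "of_rat q < s + e"
      using of_rat_dense[of s "s + e"] \<open>e > 0\<close> by auto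
    then show "\<exists>q::rat. \<bar>coord (min (max 0 (of_rat q)) T) \<omega>\<bar> < 1 / Suc n"
      by (intro exI[of _ q] e) auto
  qed
next
  assume *: "\<forall>n::nat. \<exists>q::rat. \<bar>coord (min (max 0 (of_rat q)) T) \<omega>\<bar> < 1 / Suc n"
  have "continuous_on {0..T} (\<lambda>s. \<bar>coord s \<omega>\<bar>)"
    by (intro continuous_intros continuous_on_subset[OF continuous_on_coord[OF \<omega>]]) auto
  then obtain s where s: "s \<in> {0..T}" "\<And>t. t \<in> {0..T} \<Longrightarrow> \<bar>coord s \<omega>\<bar> \<le> \<bar>coord t \<omega>\<bar>"
    using continuous_attains_inf[of "{0..T}"] T by (metis atLeastatMost_empty_iff2 compact_Icc not_less)
  have "\<bar>coord s \<omega>\<bar> < 1 / Suc n" for n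
  proof -
    obtain q :: rat where "\<bar>coord (min (max 0 (of_rat q)) T) \<omega>\<bar> < 1 / Suc n" using * by blast
    moreover have "min (max 0 (of_rat q)) T \<in> {0..T}" using T by auto
    ultimately show ?thesis using s(2) by fastforce
  qed
  then have "\<not> 0 < \<bar>coord s \<omega>\<bar>"
    by (metis nat_approx_posE not_less_iff_gr_or_eq)
  with s(1) show "\<exists>s\<in>{0..T}. coord s \<omega> = 0" by auto
qed

text \<open>\<open>T\<close> may be random, and only values of the stopped process have to be
  measurable. This serves both a constant \<open>T = K\<close> with the sigma-algebra at time
  \<open>K\<close>, and \<open>T = \<tau>\<close> on the whole path space.\<close>

lemma pred_hit_zero_le:
  assumes "space M \<subseteq> paths" "\<And>\<omega>. \<omega> \<in> space M \<Longrightarrow> 0 \<le> T \<omega>"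
    and [measurable]: "\<And>s. 0 \<le> s \<Longrightarrow> (\<lambda>\<omega>. coord (min s (T \<omega>)) \<omega>) \<in> borel_measurable M"
  shows "Measurable.pred M (\<lambda>\<omega>. hit_zero \<omega> \<le> ereal (T \<omega>))"
proof -
  have "Measurable.pred M (\<lambda>\<omega>. \<forall>n::nat. \<exists>q::rat. \<bar>coord (min (max 0 (of_rat q)) (T \<omega>)) \<omega>\<bar> < 1 / Suc n)"
    by measurable
  then show ?thesis
    by (rule measurable_cong[THEN iffD1, rotated]) (use assms(1,2) in \<open>auto simp: hit_zero_le_iff_rat\<close>)
qed

text \<open>By the intermediate value theorem a path that starts positive cannot become nonpositive
  without a zero. The uncountable quantifier over times thus becomes a countable one over
  \<open>n\<close>, which gives measurability.\<close>

lemma pos_iff_not_hit_zero: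
  assumes "\<omega> \<in> paths"
  shows "(\<forall>t\<ge>0. 0 < coord t \<omega>) \<longleftrightarrow> 0 < coord 0 \<omega> \<and> (\<forall>n::nat. \<not> hit_zero \<omega> \<le> ereal (real n))"
proof
  assume "\<forall>t\<ge>0. 0 < coord t \<omega>"
  then show "0 < coord 0 \<omega> \<and> (\<forall>n::nat. \<not> hit_zero \<omega> \<le> ereal (real n))"
    using assms by (force simp: hit_zero_le_iff)
next
  assume *: "0 < coord 0 \<omega> \<and> (\<forall>n::nat. \<not> hit_zero \<omega> \<le> ereal (real n))"
  show "\<forall>t\<ge>0. 0 < coord t \<omega>"
  proof (intro allI impI, rule ccontr)
    fix t :: real assume t: "0 \<le> t" "\<not> 0 < coord t \<omega>"
    obtain s where s: "0 \<le> s" "s \<le> t" "coord s \<omega> = 0"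
      using IVT2'[of "\<lambda>s. coord s \<omega>" t 0 0] t * continuous_on_subset[OF continuous_on_coord[OF assms], of "{0..t}"]
      by auto
    obtain n :: nat where "t \<le> n" using real_arch_simple by blast
    then have "hit_zero \<omega> \<le> ereal (real n)"
      using s assms by (subst hit_zero_le_iff) auto
    with * show False by blast
  qed
qed

lemma pred_pos_path: "Measurable.pred path_space (\<lambda>\<omega>. \<forall>t\<ge>0. 0 < coord t \<omega>)"
proof -
  note [measurable] = measurable_coord
  have [measurable]: "Measurable.pred path_space (\<lambda>\<omega>. hit_zero \<omega> \<le> ereal (real n))" for n :: nat
    by (rule pred_hit_zero_le) auto
  have "Measurable.pred path_space (\<lambda>\<omega>. 0 < coord 0 \<omega> \<and> (\<forall>n::nat. \<not> hit_zero \<omega> \<le> ereal (real n)))"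
    by measurable
  then show ?thesis
    by (rule measurable_cong[THEN iffD1, rotated]) (simp add: pos_iff_not_hit_zero)
qed

section \<open>The reciprocal map on path space\<close>

lemma recip_path_in_paths:
  assumes \<omega>: "\<omega> \<in> paths"
  shows "recip_path \<omega> \<in> paths"
proof -
  have "continuous_on {0..} (\<lambda>t\<in>{0..}. 1 / coord t \<omega>)" if "\<forall>t\<ge>0. 0 < coord t \<omega>"
  proof -
    have "continuous_on {0..} (\<lambda>t. 1 / coord t \<omega>)"
      using that continuous_on_coord[OF \<omega>] by (intro continuous_intros) force+
    then show ?thesis
      by (rule continuous_on_cong[THEN iffD1, rotated 2]) auto
  qed
  with \<omega> show ?thesis
    by (auto simp: recip_path_def paths_def)
qed

lemma measurable_recip_path: "recip_path \<in> measurable path_space path_space"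
proof (rule measurable_into_path_space)
  show "recip_path \<omega> \<in> paths" if "\<omega> \<in> space path_space" for \<omega>
    using that by (simp add: recip_path_in_paths)
next
  fix s :: real assume s: "0 \<le> s"
  note [measurable] = measurable_coord pred_pos_path
  have "(\<lambda>\<omega>. coord s (recip_path \<omega>)) = (\<lambda>\<omega>. if \<forall>t\<ge>0. 0 < coord t \<omega> then 1 / coord s \<omega> else coord s \<omega>)"
    using s by (intro ext) (simp add: recip_path_def coord_def restrict_def if_distrib[where f = "\<lambda>f. f s"] cong: if_cong)
  also have "\<dots> \<in> borel_measurable path_space"
    using s by measurable
  finally show "(\<lambda>\<omega>. coord s (recip_path \<omega>)) \<in> borel_measurable path_space" .
qed

section \<open>Change of measure at a stopping time\<close>

text \<open>Rounding goes up, so that the event that the index equals \<open>k\<close> is already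
  decided at time \<open>k / Suc n\<close>; rounding down would look into the future.\<close>

definition grid_index :: "nat \<Rightarrow> ('a \<Rightarrow> real) \<Rightarrow> 'a \<Rightarrow> nat" where
  "grid_index n \<tau> \<omega> = nat \<lceil>\<tau> \<omega> * Suc n\<rceil>"

definition grid_time :: "nat \<Rightarrow> ('a \<Rightarrow> real) \<Rightarrow> 'a \<Rightarrow> real" where
  "grid_time n \<tau> \<omega> = grid_index n \<tau> \<omega> / Suc n"

text \<open>The subtraction \<open>real k - 1\<close> is taken in the reals: for
  \<open>k = 0\<close> the bound is negative and the second condition holds automatically, since
  \<tau> is nonnegative there.\<close>

lemma grid_index_eq_iff:
  assumes "0 \<le> \<tau> \<omega>"
  shows "grid_index n \<tau> \<omega> = k \<longleftrightarrow> \<tau> \<omega> \<le> k / Suc n \<and> \<not> \<tau> \<omega> \<le> (real k - 1) / Suc n"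
proof -
  have 1: "\<tau> \<omega> \<le> x / Suc n \<longleftrightarrow> \<tau> \<omega> * Suc n \<le> x" for x
    by (simp add: pos_le_divide_eq)
  have "0 \<le> \<tau> \<omega> * Suc n" using assms by simp
  then show ?thesis
    unfolding grid_index_def 1 by linarith
qed

lemma grid_time_bounds:
  assumes "0 \<le> \<tau> \<omega>"
  shows "\<tau> \<omega> \<le> grid_time n \<tau> \<omega>" "grid_time n \<tau> \<omega> \<le> \<tau> \<omega> + 1 / Suc n"
  using grid_index_eq_iff[of \<tau> \<omega> n "grid_index n \<tau> \<omega>", OF assms]
  by (auto simp: grid_time_def diff_divide_distrib)

lemma grid_time_tendsto:
  assumes "0 \<le> \<tau> \<omega>"
  shows "(\<lambda>n. grid_time n \<tau> \<omega>) \<longlonglongrightarrow> \<tau> \<omega>"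
by (rule tendsto_of_le_add_inverse) (rule grid_time_bounds[of \<tau> \<omega>, OF assms])+

lemma coord_grid_time_tendsto:
  assumes "\<omega> \<in> paths" "0 \<le> \<tau> \<omega>"
  shows "(\<lambda>n. coord (grid_time n \<tau> \<omega>) \<omega>) \<longlonglongrightarrow> coord (\<tau> \<omega>) \<omega>"
  using assms by (intro tendsto_coord grid_time_tendsto) (auto simp: grid_time_def)

lemma pred_stopping_time:
  assumes "stopping_time path_filtration \<tau>"
  shows "Measurable.pred path_space (\<lambda>\<omega>. \<tau> \<omega> \<le> t)"
  using assms subalgebra_path_filtration measurable_from_subalg unfolding stopping_time_def by blast

text \<open>A grid time takes countably many values, so the coordinate there is measurable piece by
  piece; path continuity passes this to the limit. Stating it for all measurable times covers grid
  times and \<open>min s (\<tau> \<omega>)\<close> as well.\<close>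

lemma measurable_coord_at_time:
  assumes [measurable]: "\<tau> \<in> borel_measurable path_space" and "\<And>\<omega>. \<omega> \<in> paths \<Longrightarrow> 0 \<le> \<tau> \<omega>"
  shows "(\<lambda>\<omega>. coord (\<tau> \<omega>) \<omega>) \<in> borel_measurable path_space"
proof (rule borel_measurable_LIMSEQ_real)
  show "(\<lambda>\<omega>. coord (grid_time n \<tau> \<omega>) \<omega>) \<in> borel_measurable path_space" for n
    unfolding grid_time_def
  proof (rule measurable_compose_countable[where f = "\<lambda>k. coord (real k / real (Suc n))" and g = "grid_index n \<tau>"])
    show "grid_index n \<tau> \<in> measurable path_space (count_space UNIV)"
      unfolding grid_index_def by measurable
  qed (simp add: measurable_coord)
qed (use assms(2) in \<open>auto intro: coord_grid_time_tendsto\<close>)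

lemma measurable_stopping_time:
  assumes "stopping_time path_filtration \<tau>"
  shows "\<tau> \<in> borel_measurable path_space"
  using pred_stopping_time[OF assms] by (auto simp: borel_measurable_iff_le pred_def)

lemma pred_grid_index:
  assumes \<tau>: "stopping_time path_filtration \<tau>" and pos: "\<And>\<omega>. \<omega> \<in> paths \<Longrightarrow> 0 \<le> \<tau> \<omega>"
  shows "Measurable.pred (path_filtration (k / Suc n)) (\<lambda>\<omega>. grid_index n \<tau> \<omega> = k)"
proof -
  let ?F = "path_filtration (k / Suc n)"
  have *: "Measurable.pred ?F (\<lambda>\<omega>. \<tau> \<omega> \<le> t)" if "t \<le> k / Suc n" for t
    using \<tau> measurable_from_subalg[OF subalgebra_path_filtration_mono[OF that]]
    unfolding stopping_time_def by blast
  have [measurable]: "Measurable.pred ?F (\<lambda>\<omega>. \<tau> \<omega> \<le> (real k - 1) / Suc n)"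
    "Measurable.pred ?F (\<lambda>\<omega>. \<tau> \<omega> \<le> k / Suc n)"
    by (auto intro!: * divide_right_mono simp del: of_nat_Suc)
  have "Measurable.pred ?F (\<lambda>\<omega>. \<tau> \<omega> \<le> k / Suc n \<and> \<not> \<tau> \<omega> \<le> (real k - 1) / Suc n)"
    by measurable
  then show ?thesis
    by (rule measurable_cong[THEN iffD1, rotated]) (use pos in \<open>simp add: grid_index_eq_iff\<close>)
qed

section \<open>Integrals under \<open>P\<close> as weighted integrals under \<open>Q\<close>, at
  fixed and then at random times\<close>

locale coord_density =
  fixes P Q :: "(real \<Rightarrow> real) measure"
  assumes P_prob: "prob_space P" and Q_prob: "prob_space Q"
    and sets_P [measurable_cong]: "sets P = sets path_space"
    and sets_Q [measurable_cong]: "sets Q = sets path_space"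
    and coord_nonneg: "AE \<omega> in Q. \<forall>t\<ge>0. 0 \<le> coord t \<omega>"
    and coord_integrable: "\<And>t. 0 \<le> t \<Longrightarrow> integrable Q (coord t)"
    and measure_P: "\<And>t A. 0 \<le> t \<Longrightarrow> A \<in> sets (path_filtration t) \<Longrightarrow>
      measure P A = (\<integral>\<omega>. coord t \<omega> * indicator A \<omega> \<partial>Q)"
begin

sublocale P: prob_space P by (rule P_prob)
sublocale Q: prob_space Q by (rule Q_prob)

lemma space_PQ [simp]: "space P = paths" "space Q = paths"
  using sets_eq_imp_space_eq[OF sets_P] sets_eq_imp_space_eq[OF sets_Q] by simp_all

lemma emeasure_PQ_paths [simp]: "emeasure P paths = 1" "emeasure Q paths = 1"
  using P.emeasure_space_1 Q.emeasure_space_1 by simp_all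

lemma subalgebra_P: "subalgebra P (path_filtration t)"
  and subalgebra_Q: "subalgebra Q (path_filtration t)"
  using subalgebra_path_filtration[of t] by (auto simp: subalgebra_def sets_P sets_Q)

text \<open>Integrability and almost sure nonnegativity of the coordinate turn the Bochner integral
  in \<open>measure_P\<close> into a nonnegative integral.\<close>

lemma emeasure_P:
  assumes t: "0 \<le> t" and A: "A \<in> sets (path_filtration t)"
  shows "emeasure P A = (\<integral>\<^sup>+\<omega>. ennreal (coord t \<omega>) * indicator A \<omega> \<partial>Q)"
proof -
  have A': "A \<in> sets Q"
    using subalgebra_Q[of t] A by (auto simp: subalgebra_def)
  have "(\<integral>\<^sup>+\<omega>. ennreal (coord t \<omega>) * indicator A \<omega> \<partial>Q) = (\<integral>\<^sup>+\<omega>. ennreal (coord t \<omega> * indicator A \<omega>) \<partial>Q)"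
    by (intro nn_integral_cong) (simp split: split_indicator)
  also have "\<dots> = ennreal (\<integral>\<omega>. coord t \<omega> * indicator A \<omega> \<partial>Q)"
    using coord_nonneg t
    by (intro nn_integral_eq_integral integrable_real_mult_indicator coord_integrable A')
      (auto elim!: AE_mp)
  finally show ?thesis
    using measure_P[OF t A] P.emeasure_eq_measure by simp
qed

text \<open>The density \<open>coord t\<close> is only valid on the sigma-algebra at time
  \<open>t\<close>. Both measures are therefore restricted to it, where they coincide, and the
  integral of an adapted \<open>f\<close> sees only the restriction.\<close>

lemma nn_integral_P_adapted:
  assumes t: "0 \<le> t" and f: "f \<in> borel_measurable (path_filtration t)"
  shows "(\<integral>\<^sup>+\<omega>. f \<omega> \<partial>P) = (\<integral>\<^sup>+\<omega>. ennreal (coord t \<omega>) * f \<omega> \<partial>Q)"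
proof -
  have [measurable]: "coord t \<in> borel_measurable Q" "f \<in> borel_measurable Q"
    using measurable_coord[OF t] measurable_from_subalg[OF subalgebra_Q f]
    by (simp_all add: measurable_cong_sets[OF sets_Q refl])
  let ?D = "density Q (\<lambda>\<omega>. ennreal (coord t \<omega>))"
  have D: "subalgebra ?D (path_filtration t)"
    using subalgebra_Q by (simp add: subalgebra_def)
  have "restr_to_subalg P (path_filtration t) = restr_to_subalg ?D (path_filtration t)"
  proof (rule measure_eqI)
    fix A assume "A \<in> sets (restr_to_subalg P (path_filtration t))"
    then have A: "A \<in> sets (path_filtration t)"
      by (simp add: sets_restr_to_subalg[OF subalgebra_P])
    then have "A \<in> sets Q"
      using subalgebra_Q by (auto simp: subalgebra_def)
    with A show "emeasure (restr_to_subalg P (path_filtration t)) A = emeasure (restr_to_subalg ?D (path_filtration t)) A"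
      by (simp add: emeasure_restr_to_subalg subalgebra_P D emeasure_P[OF t] emeasure_density)
  qed (simp add: sets_restr_to_subalg subalgebra_P D)
  then have "(\<integral>\<^sup>+\<omega>. f \<omega> \<partial>P) = (\<integral>\<^sup>+\<omega>. f \<omega> \<partial>?D)"
    using nn_integral_subalgebra2[OF subalgebra_P f] nn_integral_subalgebra2[OF D f] by simp
  then show ?thesis
    by (simp add: nn_integral_density)
qed

lemma nn_integral_P_grid:
  fixes \<phi> :: "real \<Rightarrow> ennreal"
  assumes \<tau>: "stopping_time path_filtration \<tau>" and pos: "\<And>\<omega>. \<omega> \<in> paths \<Longrightarrow> 0 \<le> \<tau> \<omega>"
    and [measurable]: "\<phi> \<in> borel_measurable borel"
  shows "(\<integral>\<^sup>+\<omega>. \<phi> (coord (grid_time n \<tau> \<omega>) \<omega>) \<partial>P) =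
    (\<integral>\<^sup>+\<omega>. ennreal (coord (grid_time n \<tau> \<omega>) \<omega>) * \<phi> (coord (grid_time n \<tau> \<omega>) \<omega>) \<partial>Q)"
proof -
  define A where "A k = {\<omega> \<in> paths. grid_index n \<tau> \<omega> = k}" for k
  have A: "A k \<in> sets (path_filtration (k / Suc n))" for k
    using pred_grid_index[OF \<tau> pos, where n = n and k = k] by (simp add: pred_def A_def)
  have AQ [measurable]: "A k \<in> sets path_space" for k
    using A[of k] subalgebra_path_filtration by (auto simp: subalgebra_def)
  \<comment> \<open>Exactly one term of the series is nonzero at each path. Each summand is then
    adapted to its own time \<open>k / Suc n\<close>, where the fixed-time density applies.\<close>
  have split: "(\<integral>\<^sup>+\<omega>. F (coord (grid_time n \<tau> \<omega>) \<omega>) \<partial>M) =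
      (\<integral>\<^sup>+\<omega>. (\<Sum>k. F (coord (k / Suc n) \<omega>) * indicator (A k) \<omega>) \<partial>M)"
    if "space M = paths" for F :: "real \<Rightarrow> ennreal" and M
  proof (rule nn_integral_cong)
    fix \<omega> assume "\<omega> \<in> space M"
    with that have "F (coord (k / Suc n) \<omega>) * indicator (A k) \<omega> =
        (if k = grid_index n \<tau> \<omega> then F (coord (k / Suc n) \<omega>) else 0)" for k
      by (simp add: A_def)
    then show "F (coord (grid_time n \<tau> \<omega>) \<omega>) = (\<Sum>k. F (coord (k / Suc n) \<omega>) * indicator (A k) \<omega>)"
      using sums_unique[OF sums_single[of "grid_index n \<tau> \<omega>" "\<lambda>k. F (coord (k / Suc n) \<omega>)"]]
      by (simp only: grid_time_def)
  qed
  have [measurable]: "coord (real k / real (Suc n)) \<in> borel_measurable path_space" for k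
    by (simp add: measurable_coord)
  have "(\<integral>\<^sup>+\<omega>. \<phi> (coord (grid_time n \<tau> \<omega>) \<omega>) \<partial>P) =
      (\<integral>\<^sup>+\<omega>. (\<Sum>k. \<phi> (coord (k / Suc n) \<omega>) * indicator (A k) \<omega>) \<partial>P)"
    by (rule split) simp
  also have "\<dots> = (\<Sum>k. \<integral>\<^sup>+\<omega>. \<phi> (coord (k / Suc n) \<omega>) * indicator (A k) \<omega> \<partial>P)"
    by (intro nn_integral_suminf) measurable
  also have "\<dots> = (\<Sum>k. \<integral>\<^sup>+\<omega>. ennreal (coord (k / Suc n) \<omega>) * (\<phi> (coord (k / Suc n) \<omega>) * indicator (A k) \<omega>) \<partial>Q)"
  proof (intro suminf_cong nn_integral_P_adapted)
    fix k :: nat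
    have [measurable]: "coord (k / Suc n) \<in> borel_measurable (path_filtration (k / Suc n))"
      by (rule measurable_coord_filtration) auto
    note A[measurable]
    show "(\<lambda>\<omega>. \<phi> (coord (k / Suc n) \<omega>) * indicator (A k) \<omega>) \<in> borel_measurable (path_filtration (k / Suc n))"
      by measurable
  qed simp
  also have "\<dots> = (\<integral>\<^sup>+\<omega>. (\<Sum>k. ennreal (coord (k / Suc n) \<omega>) * (\<phi> (coord (k / Suc n) \<omega>) * indicator (A k) \<omega>)) \<partial>Q)"
    by (intro nn_integral_suminf[symmetric]) measurable
  also have "\<dots> = (\<integral>\<^sup>+\<omega>. ennreal (coord (grid_time n \<tau> \<omega>) \<omega>) * \<phi> (coord (grid_time n \<tau> \<omega>) \<omega>) \<partial>Q)"
    using split[of Q "\<lambda>x. ennreal x * \<phi> x"] by (simp only: space_PQ mult.assoc)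
  finally show ?thesis .
qed

text \<open>The cutoff \<open>\<phi>\<close> bounds both integrands, so that dominated convergence replaces uniform
  integrability of the discretized values.\<close>

lemma nn_integral_P_stopped:
  fixes \<phi> :: "real \<Rightarrow> real"
  assumes \<tau>: "stopping_time path_filtration \<tau>" and pos: "\<And>\<omega>. \<omega> \<in> paths \<Longrightarrow> 0 \<le> \<tau> \<omega>"
    and cont: "continuous_on UNIV \<phi>" and \<phi>: "\<And>x. 0 \<le> \<phi> x" "\<And>x. \<phi> x \<le> 1" "\<And>x. b < x \<Longrightarrow> \<phi> x = 0"
  shows "(\<integral>\<^sup>+\<omega>. ennreal (\<phi> (coord (\<tau> \<omega>) \<omega>)) \<partial>P) =
    (\<integral>\<^sup>+\<omega>. ennreal (coord (\<tau> \<omega>) \<omega>) * ennreal (\<phi> (coord (\<tau> \<omega>) \<omega>)) \<partial>Q)"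
proof (rule LIMSEQ_unique)
  have [measurable]: "\<phi> \<in> borel_measurable borel"
    using cont by (rule borel_measurable_continuous_onI)
  have [measurable]: "\<tau> \<in> borel_measurable path_space"
    by (rule measurable_stopping_time[OF \<tau>])
  have [measurable]: "(\<lambda>\<omega>. coord (\<tau> \<omega>) \<omega>) \<in> borel_measurable path_space"
    by (rule measurable_coord_at_time) (auto simp: pos)
  have [measurable]: "(\<lambda>\<omega>. coord (grid_time n \<tau> \<omega>) \<omega>) \<in> borel_measurable path_space" for n
    by (rule measurable_coord_at_time) (auto simp: grid_time_def grid_index_def)
  have lim: "(\<lambda>n. F (coord (grid_time n \<tau> \<omega>) \<omega>)) \<longlonglongrightarrow> F (coord (\<tau> \<omega>) \<omega>)"
    if "\<omega> \<in> paths" "continuous_on UNIV F" for \<omega> and F :: "real \<Rightarrow> ennreal"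
    using continuous_on_tendsto_compose[OF that(2) coord_grid_time_tendsto[of \<omega> \<tau>, OF that(1) pos[OF that(1)]]]
    by simp
  \<comment> \<open>\<open>ennreal\<close> truncates negative reals to 0; writing the product with
    \<open>max 0 x\<close> exhibits it as a continuous function of \<open>x\<close>.\<close>
  have eq: "ennreal x * ennreal (\<phi> x) = ennreal (max 0 x * \<phi> x)" for x
    using \<phi>(1) by (cases "0 \<le> x") (auto simp: ennreal_mult max_def ennreal_neg)
  \<comment> \<open>Both sides of the claim are limits of this one sequence: directly under
    \<open>P\<close>, and after the grid identity under \<open>Q\<close>.\<close>
  show "(\<lambda>n. \<integral>\<^sup>+\<omega>. ennreal (\<phi> (coord (grid_time n \<tau> \<omega>) \<omega>)) \<partial>P) \<longlonglongrightarrow> (\<integral>\<^sup>+\<omega>. ennreal (\<phi> (coord (\<tau> \<omega>) \<omega>)) \<partial>P)"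
  proof (rule nn_integral_dominated_convergence[where w = "\<lambda>_. 1"])
    show "AE \<omega> in P. (\<lambda>n. ennreal (\<phi> (coord (grid_time n \<tau> \<omega>) \<omega>))) \<longlonglongrightarrow> ennreal (\<phi> (coord (\<tau> \<omega>) \<omega>))"
      using cont by (intro AE_I2 lim continuous_on_ennreal) auto
  qed (auto simp: \<phi>)
  show "(\<lambda>n. \<integral>\<^sup>+\<omega>. ennreal (\<phi> (coord (grid_time n \<tau> \<omega>) \<omega>)) \<partial>P) \<longlonglongrightarrow>
      (\<integral>\<^sup>+\<omega>. ennreal (coord (\<tau> \<omega>) \<omega>) * ennreal (\<phi> (coord (\<tau> \<omega>) \<omega>)) \<partial>Q)"
    unfolding nn_integral_P_grid[OF \<tau> pos, of "\<lambda>x. ennreal (\<phi> x)", simplified]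
  proof (rule nn_integral_dominated_convergence[where w = "\<lambda>_. ennreal (max 0 b)"])
    show "AE \<omega> in Q. (\<lambda>n. ennreal (coord (grid_time n \<tau> \<omega>) \<omega>) * ennreal (\<phi> (coord (grid_time n \<tau> \<omega>) \<omega>)))
        \<longlonglongrightarrow> ennreal (coord (\<tau> \<omega>) \<omega>) * ennreal (\<phi> (coord (\<tau> \<omega>) \<omega>))"
      unfolding eq using cont
      by (intro AE_I2 lim[of _ "\<lambda>x. ennreal (max 0 x * \<phi> x)"] continuous_on_ennreal continuous_intros) auto
    have "max 0 x * \<phi> x \<le> max 0 b" for x
    proof (cases "x \<le> b")
      case True
      then show ?thesis using \<phi>(1,2)[of x] mult_mono[of "max 0 x" "max 0 b" "\<phi> x" 1] by auto
    qed (use \<phi>(3)[of x] in auto)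
    then show "AE \<omega> in Q. ennreal (coord (grid_time n \<tau> \<omega>) \<omega>) * ennreal (\<phi> (coord (grid_time n \<tau> \<omega>) \<omega>)) \<le> ennreal (max 0 b)" for n
      unfolding eq by (intro AE_I2 ennreal_leI)
  qed auto
qed

text \<open>Closed half-lines determine a finite measure on the line, and their indicators are
  limits of continuous cutoffs, for which the identity is known. The density \<open>ennreal\<close>
  is the positive part of the identity function.\<close>

lemma distr_coord_stopped:
  assumes \<tau>: "stopping_time path_filtration \<tau>" and pos: "\<And>\<omega>. \<omega> \<in> paths \<Longrightarrow> 0 \<le> \<tau> \<omega>"
  shows "distr P borel (\<lambda>\<omega>. coord (\<tau> \<omega>) \<omega>) = density (distr Q borel (\<lambda>\<omega>. coord (\<tau> \<omega>) \<omega>)) ennreal"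
    (is "?M = ?N")
proof (rule measure_eqI_generator_eq)
  have [measurable]: "\<tau> \<in> borel_measurable path_space"
    by (rule measurable_stopping_time[OF \<tau>])
  have X [measurable]: "(\<lambda>\<omega>. coord (\<tau> \<omega>) \<omega>) \<in> borel_measurable path_space"
    by (rule measurable_coord_at_time) (auto simp: pos)
  have XP [measurable]: "(\<lambda>\<omega>. coord (\<tau> \<omega>) \<omega>) \<in> borel_measurable P"
    and XQ [measurable]: "(\<lambda>\<omega>. coord (\<tau> \<omega>) \<omega>) \<in> borel_measurable Q"
    by measurable
  show "Int_stable (range (atMost :: real \<Rightarrow> _))"
    by (auto simp: Int_stable_def)
  show "sets ?M = sigma_sets UNIV (range atMost)" "sets ?N = sigma_sets UNIV (range atMost)"
    by (simp_all add: borel_eq_atMost)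
  show "range (\<lambda>n::nat. {..real n}) \<subseteq> range atMost" "(\<Union>n::nat. {..real n}) = UNIV"
    by (auto simp: real_arch_simple)
  interpret M: prob_space ?M
    by (rule P.prob_space_distr) measurable
  show "emeasure ?M {..real n} \<noteq> \<infinity>" for n :: nat
    using M.emeasure_finite by auto
  fix S :: "real set" assume "S \<in> range atMost"
  then obtain c where S: "S = {..c}" by auto
  \<comment> \<open>For positive \<open>m\<close> this equals 1 up to \<open>c\<close> and falls
    linearly to 0 at \<open>c + 1/m\<close>. It is used at \<open>Suc m\<close>, since for
    \<open>m = 0\<close> it would be constantly 1 and not vanish beyond
    \<open>c + 1\<close>.\<close>
  define \<phi> where "\<phi> m x = max 0 (1 - real m * max 0 (x - c))" for m :: nat and x
  have [measurable]: "\<phi> m \<in> borel_measurable borel" for m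
    unfolding \<phi>_def by measurable
  have \<phi>01: "0 \<le> \<phi> m x" "\<phi> m x \<le> 1" for m x
    by (auto simp: \<phi>_def)
  have \<phi>0: "\<phi> m x = 0" if "c + 1 < x" "0 < m" for m x
  proof -
    have "1 * 1 \<le> real m * (x - c)" using that by (intro mult_mono) auto
    then show ?thesis using that by (auto simp: \<phi>_def max_def)
  qed
  have lim: "(\<lambda>m. \<phi> (Suc m) x) \<longlonglongrightarrow> indicator S x" for x
  proof (cases "x \<le> c")
    case True then show ?thesis by (simp add: \<phi>_def S)
  next
    case False
    obtain k :: nat where k: "1 / (x - c) \<le> k" using real_arch_simple by blast
    have "\<phi> (Suc m) x = 0" if "k \<le> m" for m
    proof -
      have "1 / (x - c) \<le> Suc m" using k that by linarith
      then have "1 \<le> Suc m * (x - c)" using False by (simp add: pos_divide_le_eq)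
      then show ?thesis using False by (auto simp: \<phi>_def max_def)
    qed
    then have "eventually (\<lambda>m. \<phi> (Suc m) x = 0) sequentially"
      using eventually_sequentially by blast
    then show ?thesis
      using False by (simp add: S tendsto_eventually)
  qed
  show "emeasure ?M S = emeasure ?N S"
  proof (rule LIMSEQ_unique)
    let ?L = "\<lambda>m. \<integral>\<^sup>+\<omega>. ennreal (\<phi> (Suc m) (coord (\<tau> \<omega>) \<omega>)) \<partial>P"
    have [measurable]: "S \<in> sets borel" by (simp add: S)
    have "?L \<longlonglongrightarrow> (\<integral>\<^sup>+\<omega>. ennreal (indicator S (coord (\<tau> \<omega>) \<omega>)) \<partial>P)"
      by (rule nn_integral_dominated_convergence[where w = "\<lambda>_. 1"])
        (auto simp: \<phi>01 intro!: tendsto_ennrealI lim)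
    also have "(\<integral>\<^sup>+\<omega>. ennreal (indicator S (coord (\<tau> \<omega>) \<omega>)) \<partial>P) = (\<integral>\<^sup>+x. indicator S x \<partial>?M)"
      by (subst nn_integral_distr) (simp_all add: ennreal_indicator)
    finally show "?L \<longlonglongrightarrow> emeasure ?M S" by simp
    have eq: "ennreal x * ennreal (\<phi> m x) = ennreal (max 0 x * \<phi> m x)" for m x
      using \<phi>01 by (cases "0 \<le> x") (auto simp: ennreal_mult max_def ennreal_neg)
    have "?L = (\<lambda>m. \<integral>\<^sup>+\<omega>. ennreal (coord (\<tau> \<omega>) \<omega>) * ennreal (\<phi> (Suc m) (coord (\<tau> \<omega>) \<omega>)) \<partial>Q)"
    proof (intro ext nn_integral_P_stopped[OF \<tau> pos, where b = "c + 1"] \<phi>01 \<phi>0)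
      show "continuous_on UNIV (\<phi> (Suc m))" for m
        unfolding \<phi>_def[abs_def] by (intro continuous_intros)
    qed auto
    also have "\<dots> = (\<lambda>m. \<integral>\<^sup>+\<omega>. ennreal (max 0 (coord (\<tau> \<omega>) \<omega>) * \<phi> (Suc m) (coord (\<tau> \<omega>) \<omega>)) \<partial>Q)"
      by (simp only: eq)
    also have "\<dots> \<longlonglongrightarrow> (\<integral>\<^sup>+\<omega>. ennreal (max 0 (coord (\<tau> \<omega>) \<omega>) * indicator S (coord (\<tau> \<omega>) \<omega>)) \<partial>Q)"
    \<comment> \<open>The constant dominates because the cutoffs are at most 1 and all vanish beyond
      \<open>c + 1\<close>.\<close>
    proof (rule nn_integral_dominated_convergence[where w = "\<lambda>_. ennreal (max 0 (c + 1))"])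
      have "max 0 x * \<phi> (Suc m) x \<le> max 0 (c + 1)" for m x
      proof (cases "x \<le> c + 1")
        case True
        then show ?thesis
          using \<phi>01[of "Suc m" x] mult_mono[of "max 0 x" "max 0 (c + 1)" "\<phi> (Suc m) x" 1] by auto
      qed (use \<phi>0[of x "Suc m"] in auto)
      then show "AE \<omega> in Q. ennreal (max 0 (coord (\<tau> \<omega>) \<omega>) * \<phi> (Suc m) (coord (\<tau> \<omega>) \<omega>)) \<le> ennreal (max 0 (c + 1))" for m
        by (intro AE_I2 ennreal_leI)
    qed (auto simp: intro!: tendsto_ennrealI tendsto_intros lim)
    also have "(\<integral>\<^sup>+\<omega>. ennreal (max 0 (coord (\<tau> \<omega>) \<omega>) * indicator S (coord (\<tau> \<omega>) \<omega>)) \<partial>Q) =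
        (\<integral>\<^sup>+\<omega>. ennreal (coord (\<tau> \<omega>) \<omega>) * indicator S (coord (\<tau> \<omega>) \<omega>) \<partial>Q)"
      by (intro nn_integral_cong) (auto simp: max_def ennreal_neg split: split_indicator)
    also have "\<dots> = emeasure ?N S"
      by (simp add: emeasure_density nn_integral_distr)
    finally show "?L \<longlonglongrightarrow> emeasure ?N S" .
  qed
qed simp

text \<open>Since \<open>P\<close> does not charge the paths that vanish before time \<open>K\<close>, the density \<open>X\<^sub>K\<close> must vanish
  \<open>Q\<close>-almost surely on these paths; rational \<open>K\<close> and path continuity give all times at once.\<close>

lemma coord_zero_after_hit:
  assumes P_pos: "AE \<omega> in P. \<forall>t\<ge>0. 0 < coord t \<omega>"
  shows "AE \<omega> in Q. \<forall>t\<ge>0. hit_zero \<omega> \<le> ereal t \<longrightarrow> coord t \<omega> = 0"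
proof -
  have rat: "AE \<omega> in Q. hit_zero \<omega> \<le> ereal K \<longrightarrow> coord K \<omega> = 0" if K: "0 \<le> K" for K
  proof -
    define A where "A = {\<omega> \<in> paths. hit_zero \<omega> \<le> ereal K}"
    have "Measurable.pred (path_filtration K) (\<lambda>\<omega>. hit_zero \<omega> \<le> ereal K)"
      by (rule pred_hit_zero_le) (auto simp: K intro!: measurable_coord_filtration)
    then have A: "A \<in> sets (path_filtration K)"
      by (simp add: pred_def A_def)
    then have AQ [measurable]: "A \<in> sets path_space"
      using subalgebra_path_filtration by (auto simp: subalgebra_def)
    note measurable_coord[OF K, measurable]
    have "AE \<omega> in P. \<omega> \<notin> A"
      using P_pos
    proof eventually_elim
      case (elim \<omega>)
      show ?case
      proof
        assume "\<omega> \<in> A"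
        then obtain s where "0 \<le> s" "coord s \<omega> = 0"
          using hit_zero_le_iff[of \<omega> K] K by (auto simp: A_def)
        with elim show False by (metis less_irrefl)
      qed
    qed
    then have "emeasure P A = 0"
      using AQ by (subst (asm) AE_iff_measurable[where N = A]) (auto simp: A_def sets_P)
    then have "(\<integral>\<^sup>+\<omega>. ennreal (coord K \<omega>) * indicator A \<omega> \<partial>Q) = 0"
      using emeasure_P[OF K A] by simp
    then have "AE \<omega> in Q. ennreal (coord K \<omega>) * indicator A \<omega> = 0"
      by (subst (asm) nn_integral_0_iff_AE) measurable
    from coord_nonneg this AE_space[of Q] show ?thesis
    proof eventually_elim
      case (elim \<omega>)
      show ?case
      proof
        assume "hit_zero \<omega> \<le> ereal K"
        then have "\<omega> \<in> A" using elim(3) by (simp add: A_def)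
        \<comment> \<open>A vanishing \<open>ennreal\<close> value only says that the real number is
          nonpositive; equality needs the nonnegativity of the path.\<close>
        then have "coord K \<omega> \<le> 0" using elim(2) by (simp add: ennreal_eq_0_iff)
        moreover have "0 \<le> coord K \<omega>" using elim(1) K by blast
        ultimately show "coord K \<omega> = 0" by simp
      qed
    qed
  qed
  have "AE \<omega> in Q. \<forall>q::rat. 0 \<le> q \<longrightarrow> hit_zero \<omega> \<le> ereal (of_rat q) \<longrightarrow> coord (of_rat q) \<omega> = 0"
    using rat by (auto simp: AE_all_countable)
  with AE_space[of Q] show ?thesis
  proof eventually_elim
    case (elim \<omega>)
    then have \<omega>: "\<omega> \<in> paths" by simp
    show ?case
    proof (intro allI impI)
      fix t :: real assume t: "0 \<le> t" "hit_zero \<omega> \<le> ereal t"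
      \<comment> \<open>The approximating rationals lie above \<open>t\<close>, so they too are past
        the hitting time.\<close>
      have "\<exists>q::rat. t < of_rat q \<and> of_rat q < t + 1 / Suc n" for n
        by (rule of_rat_dense) simp
      then obtain q :: "nat \<Rightarrow> rat" where q: "\<And>n. t < of_rat (q n)" "\<And>n. of_rat (q n) < t + 1 / Suc n"
        by metis
      have q0: "0 \<le> real_of_rat (q n)" for n
        using t(1) q(1)[of n] by linarith
      have "(\<lambda>n. of_rat (q n) :: real) \<longlonglongrightarrow> t"
        using q by (intro tendsto_of_le_add_inverse) (auto intro: less_imp_le simp del: of_nat_Suc)
      then have "(\<lambda>n. coord (of_rat (q n)) \<omega>) \<longlonglongrightarrow> coord t \<omega>"
        using \<omega> t q0 by (intro tendsto_coord) auto
      moreover have "coord (of_rat (q n)) \<omega> = 0" for n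
      proof -
        have "hit_zero \<omega> \<le> ereal (of_rat (q n))"
          using t(2) q(1)[of n] by (meson ereal_less_eq(3) less_imp_le order_trans)
        then show ?thesis using elim q0[of n] by auto
      qed
      ultimately show "coord t \<omega> = 0"
        by (simp add: LIMSEQ_const_iff)
    qed
  qed
qed

end

section \<open>The identity for \<open>h\<close> and its form with the continuous extension of
  \<open>g\<close>\<close>

theorem proposition7:
  fixes R Q P :: "(real \<Rightarrow> real) measure"
    and h g :: "real \<Rightarrow> real"
    and \<tau> :: "(real \<Rightarrow> real) \<Rightarrow> real"
  assumes R_prob: "prob_space R" and R_sets: "sets R = sets path_space"
    and Q_prob: "prob_space Q" and Q_sets: "sets Q = sets path_space"
    and P_prob: "prob_space P" and P_sets: "sets P = sets path_space"
    and R_pos: "AE \<omega> in R. \<forall>t\<ge>0. 0 < coord t \<omega>"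
    and R_strict: "strict_local_martingale R path_filtration coord"
    and Q_nonneg: "AE \<omega> in Q. \<forall>t\<ge>0. 0 \<le> coord t \<omega>"
    and Q_mart: "martingale Q path_filtration coord"
    and P_def: "\<And>t A. 0 \<le> t \<Longrightarrow> A \<in> sets (path_filtration t) \<Longrightarrow>
                  measure P A = (\<integral>\<omega>. coord t \<omega> * indicator A \<omega> \<partial>Q)"
    and P_law: "P = distr R path_space recip_path"
    and h_meas: "h \<in> borel_measurable (restrict_space borel {0<..})"
    and h_nonneg: "\<And>x. 0 < x \<Longrightarrow> 0 \<le> h x"
    and tau: "bounded_stopping_time \<tau>"
    and g_def: "\<And>x. 0 < x \<Longrightarrow> g x = x * h (1 / x)"
  shows "(\<integral>\<^sup>+\<omega>. ennreal (h (coord (recip_time \<tau> \<omega>) \<omega>)) \<partial>R) =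
           (\<integral>\<^sup>+\<omega>. ennreal (g (coord (\<tau> \<omega>) \<omega>)) *
                 indicator {\<omega>. ereal (\<tau> \<omega>) < hit_zero \<omega>} \<omega> \<partial>Q) \<and>
         (\<forall>\<eta> gbar. (g \<longlongrightarrow> \<eta>) (at_right 0) \<and> (\<forall>x>0. gbar x = g x) \<and> gbar 0 = \<eta> \<longrightarrow>
           enn2ereal (\<integral>\<^sup>+\<omega>. ennreal (h (coord (recip_time \<tau> \<omega>) \<omega>)) \<partial>R) =
             enn2ereal (\<integral>\<^sup>+\<omega>. ennreal (gbar (coord (\<tau> \<omega>) \<omega>)) \<partial>Q) -
             ereal (\<eta> * measure Q {\<omega> \<in> space Q. hit_zero \<omega> \<le> ereal (\<tau> \<omega>)}))"
proof -
  have stop: "stopping_time path_filtration \<tau>" and pos: "\<And>\<omega>. \<omega> \<in> paths \<Longrightarrow> 0 \<le> \<tau> \<omega>"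
    using tau by (auto simp: bounded_stopping_time_def)
  interpret coord_density P Q
    using Q_mart by (intro coord_density.intro P_prob Q_prob P_sets Q_sets Q_nonneg P_def)
      (auto simp: martingale_def)
  have spR: "space R = paths"
    using sets_eq_imp_space_eq[OF R_sets] by simp
  note R_sets [measurable_cong]
  have rec [measurable]: "recip_path \<in> measurable R path_space"
    using measurable_recip_path by (simp add: measurable_cong_sets[OF R_sets refl])
  have [measurable]: "\<tau> \<in> borel_measurable path_space"
    by (rule measurable_stopping_time[OF stop])
  let ?X = "\<lambda>\<omega>. coord (\<tau> \<omega>) \<omega>"
  have X [measurable]: "?X \<in> borel_measurable path_space"
    by (rule measurable_coord_at_time) (auto simp: pos)
  have XP [measurable]: "?X \<in> borel_measurable P" and XQ [measurable]: "?X \<in> borel_measurable Q"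
    by measurable
  \<comment> \<open>\<open>h\<close> is measurable only on the positive half-line; extension by 0
    gives a Borel function on the whole line.\<close>
  define h' where "h' x = indicator {0<..} x *\<^sub>R h x" for x
  have h' [measurable]: "h' \<in> borel_measurable borel"
    using h_meas unfolding h'_def[abs_def] by (subst (asm) borel_measurable_restrict_space_iff) auto
  have h'_pos: "h' x = h x" if "0 < x" for x
    using that by (simp add: h'_def)
  \<comment> \<open>At \<open>X = 0\<close> the first factor annihilates the product, so the
    convention \<open>1 / 0 = 0\<close> does no harm.\<close>
  let ?G = "\<lambda>\<omega>. ennreal (?X \<omega>) * ennreal (h' (1 / ?X \<omega>))"
  have recip_pos: "0 < coord t (recip_path \<omega>) \<and> coord t \<omega> = 1 / coord t (recip_path \<omega>)"
    if "\<forall>t\<ge>0. 0 < coord t \<omega>" "0 \<le> t" for t \<omega>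
    using that by (simp add: recip_path_def coord_def)
  have P_pos: "AE \<omega> in P. \<forall>t\<ge>0. 0 < coord t \<omega>"
    unfolding P_law
  proof (subst AE_distr_iff[OF rec])
    show "AE \<omega> in R. \<forall>t\<ge>0. 0 < coord t (recip_path \<omega>)"
      using R_pos by eventually_elim (blast dest: recip_pos)
  qed (use pred_pos_path in \<open>simp add: pred_def\<close>)
  have after: "AE \<omega> in Q. \<forall>t\<ge>0. hit_zero \<omega> \<le> ereal t \<longrightarrow> coord t \<omega> = 0"
    by (rule coord_zero_after_hit[OF P_pos])
  have X_pos: "0 < ?X \<omega>"
    if "\<forall>t\<ge>0. 0 \<le> coord t \<omega>" "\<omega> \<in> paths" "\<not> hit_zero \<omega> \<le> ereal (\<tau> \<omega>)" for \<omega>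
    using that pos[of \<omega>] hit_zero_le_iff[of \<omega> "\<tau> \<omega>"] by (auto simp: less_le)
  \<comment> \<open>Under \<open>R\<close> the time is \<tau> of the reciprocal path, so the
    coordinate of \<omega> at that time is \<open>1 / X\<close> with \<open>X\<close> the stopped
    coordinate of \<open>recip_path \<omega>\<close>. The integrand thus depends on the reciprocal
    path alone, whose law is \<open>P\<close>.\<close>
  have "(\<integral>\<^sup>+\<omega>. ennreal (h (coord (recip_time \<tau> \<omega>) \<omega>)) \<partial>R) =
      (\<integral>\<^sup>+\<omega>. ennreal (h' (1 / ?X (recip_path \<omega>))) \<partial>R)"
  proof (rule nn_integral_cong_AE)
    from R_pos AE_space[of R]
    show "AE \<omega> in R. ennreal (h (coord (recip_time \<tau> \<omega>) \<omega>)) = ennreal (h' (1 / ?X (recip_path \<omega>)))"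
    proof eventually_elim
      case (elim \<omega>)
      then have "0 \<le> \<tau> (recip_path \<omega>)"
        by (simp add: spR pos recip_path_in_paths)
      from recip_pos[OF elim(1) this] show ?case
        by (simp add: recip_time_def h'_pos)
    qed
  qed
  also have "\<dots> = (\<integral>\<^sup>+\<omega>. ennreal (h' (1 / ?X \<omega>)) \<partial>P)"
    unfolding P_law by (subst nn_integral_distr[OF rec]) measurable
  also have "\<dots> = (\<integral>\<^sup>+x. ennreal (h' (1 / x)) \<partial>distr P borel ?X)"
    by (subst nn_integral_distr[OF XP]) measurable
  also have "\<dots> = (\<integral>\<^sup>+x. ennreal x * ennreal (h' (1 / x)) \<partial>distr Q borel ?X)"
    by (subst distr_coord_stopped[OF stop]) (simp_all add: pos nn_integral_density)
  also have "\<dots> = (\<integral>\<^sup>+\<omega>. ?G \<omega> \<partial>Q)"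
    by (subst nn_integral_distr[OF XQ]) measurable
  finally have lhs: "(\<integral>\<^sup>+\<omega>. ennreal (h (coord (recip_time \<tau> \<omega>) \<omega>)) \<partial>R) = (\<integral>\<^sup>+\<omega>. ?G \<omega> \<partial>Q)" .
  have G_g: "?G \<omega> = ennreal (g (?X \<omega>))" if "0 < ?X \<omega>" for \<omega>
    using that g_def[OF that] h_nonneg[of "1 / ?X \<omega>"] by (simp add: h'_pos ennreal_mult)
  show ?thesis
  proof (intro conjI allI impI)
    have "(\<integral>\<^sup>+\<omega>. ?G \<omega> \<partial>Q) =
        (\<integral>\<^sup>+\<omega>. ennreal (g (?X \<omega>)) * indicator {\<omega>. ereal (\<tau> \<omega>) < hit_zero \<omega>} \<omega> \<partial>Q)"
    \<comment> \<open>If zero is hit by time \<tau>, absorption at zero forces \<open>X = 0\<close>,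
      so \<open>?G\<close> vanishes like the indicator. Otherwise \<open>X > 0\<close> and
      \<open>?G\<close> is \<open>g\<close> of it.\<close>
    proof (rule nn_integral_cong_AE)
      from after Q_nonneg AE_space[of Q]
      show "AE \<omega> in Q. ?G \<omega> = ennreal (g (?X \<omega>)) * indicator {\<omega>. ereal (\<tau> \<omega>) < hit_zero \<omega>} \<omega>"
      proof eventually_elim
        case (elim \<omega>)
        then have \<omega>: "\<omega> \<in> paths" by simp
        show ?case
        proof (cases "hit_zero \<omega> \<le> ereal (\<tau> \<omega>)")
          case True
          then have "?X \<omega> = 0" using elim(1) pos[OF \<omega>] by blast
          with True show ?thesis by (simp add: not_less)
        next
          case False
          with G_g[OF X_pos[OF elim(2) \<omega> False]] show ?thesis by (simp add: not_le)
        qed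
      qed
    qed
    with lhs show "(\<integral>\<^sup>+\<omega>. ennreal (h (coord (recip_time \<tau> \<omega>) \<omega>)) \<partial>R) =
        (\<integral>\<^sup>+\<omega>. ennreal (g (?X \<omega>)) * indicator {\<omega>. ereal (\<tau> \<omega>) < hit_zero \<omega>} \<omega> \<partial>Q)"
      by simp
  next
    fix \<eta> gbar
    assume *: "(g \<longlongrightarrow> \<eta>) (at_right 0) \<and> (\<forall>x>0. gbar x = g x) \<and> gbar 0 = \<eta>"
    have "eventually (\<lambda>x. 0 \<le> g x) (at_right 0)"
      using eventually_at_right_less[of "0::real"]
      by eventually_elim (simp add: g_def h_nonneg)
    \<comment> \<open>Nonnegativity of \<eta> guarantees that \<open>ennreal \<eta>\<close> does not
      truncate it.\<close>
    with * have \<eta>: "0 \<le> \<eta>"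
      by (intro tendsto_lowerbound[of g \<eta> "at_right 0"]) auto
    define B where "B = {\<omega> \<in> space Q. hit_zero \<omega> \<le> ereal (\<tau> \<omega>)}"
    have "Measurable.pred path_space (\<lambda>\<omega>. hit_zero \<omega> \<le> ereal (\<tau> \<omega>))"
    proof (rule pred_hit_zero_le)
      show "(\<lambda>\<omega>. coord (min s (\<tau> \<omega>)) \<omega>) \<in> borel_measurable path_space" if "0 \<le> s" for s
        using that by (intro measurable_coord_at_time) (auto simp: pos)
    qed (auto simp: pos)
    then have B [measurable]: "B \<in> sets path_space"
      by (simp add: B_def pred_def)
    have BQ: "B \<in> sets Q"
      using B by (simp add: sets_Q)
    \<comment> \<open>The identity is first proved as a sum: on \<open>B\<close> the stopped value
      is 0 and \<open>gbar\<close> gives \<eta>, off \<open>B\<close> it agrees with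
      \<open>?G\<close>.\<close>
    have "(\<integral>\<^sup>+\<omega>. ennreal (gbar (?X \<omega>)) \<partial>Q) = (\<integral>\<^sup>+\<omega>. ?G \<omega> + ennreal \<eta> * indicator B \<omega> \<partial>Q)"
    proof (rule nn_integral_cong_AE)
      from after Q_nonneg AE_space[of Q]
      show "AE \<omega> in Q. ennreal (gbar (?X \<omega>)) = ?G \<omega> + ennreal \<eta> * indicator B \<omega>"
      proof eventually_elim
        case (elim \<omega>)
        then have \<omega>: "\<omega> \<in> paths" by simp
        show ?case
        proof (cases "hit_zero \<omega> \<le> ereal (\<tau> \<omega>)")
          case True
          then have "?X \<omega> = 0" using elim(1) pos[OF \<omega>] by blast
          with True * \<omega> show ?thesis by (simp add: B_def)
        next
          case False
          with G_g[OF X_pos[OF elim(2) \<omega> False]] * X_pos[OF elim(2) \<omega> False]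
          show ?thesis by (simp add: B_def)
        qed
      qed
    qed
    also have "\<dots> = (\<integral>\<^sup>+\<omega>. ?G \<omega> \<partial>Q) + (\<integral>\<^sup>+\<omega>. ennreal \<eta> * indicator B \<omega> \<partial>Q)"
      by (rule nn_integral_add) measurable
    also have "(\<integral>\<^sup>+\<omega>. ennreal \<eta> * indicator B \<omega> \<partial>Q) = ennreal (\<eta> * measure Q B)"
      using BQ \<eta> by (simp add: nn_integral_cmult_indicator Q.emeasure_eq_measure ennreal_mult)
    finally have "enn2ereal (\<integral>\<^sup>+\<omega>. ennreal (gbar (?X \<omega>)) \<partial>Q) =
        enn2ereal (\<integral>\<^sup>+\<omega>. ?G \<omega> \<partial>Q) + ereal (\<eta> * measure Q B)"
      using \<eta> by (simp add: plus_ennreal.rep_eq)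
    \<comment> \<open>Only the finite term \<open>\<eta> * measure Q B\<close> is moved across,
      which is legitimate in \<open>ereal\<close> even when the expectations are infinite.\<close>
    then show "enn2ereal (\<integral>\<^sup>+\<omega>. ennreal (h (coord (recip_time \<tau> \<omega>) \<omega>)) \<partial>R) =
        enn2ereal (\<integral>\<^sup>+\<omega>. ennreal (gbar (?X \<omega>)) \<partial>Q) -
        ereal (\<eta> * measure Q {\<omega> \<in> space Q. hit_zero \<omega> \<le> ereal (\<tau> \<omega>)})"
      unfolding lhs B_def[symmetric] by (cases "enn2ereal (\<integral>\<^sup>+\<omega>. ?G \<omega> \<partial>Q)") simp_all
  qed
qed

end
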